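(* For $n\ge 1$ let $N=2^n$, let $\pi$ be uniformly distributed on the group $B_n$ of nonsimple butterfly permutations, and let $h_n^{B}=h(\mathcal T(\pi))$. Then, as $n\to\infty$, $$cN^{\alpha}(1+o(1))\le \mathbb E\,h_n^{B}\le dN^{\beta}(1+o(1)),$$ where $\alpha=\log_2(3/2)\approx 0.58496$, $\beta=\log_2\xi\approx 0.913189$ with $\xi=\dfrac{1+\sqrt2+\sqrt{2\sqrt2-1}}{2}$, $c=2$, and $d=\dfrac{2}{\sqrt2+\sqrt{2\sqrt2-1}-2}\approx 2.60958$.
   Context: For a permutation $\pi\in S_k$ written in one-line notation, $\mathcal T(\pi)$ is the binary search tree obtained by inserting the keys $\pi(1),\pi(2),\dots,\pi(k)$ in this order into the initially empty tree (smaller keys go left, larger keys go right). The depth of a node is the number of edges on the path from the root to it, and $h(\mathcal T(\pi))$ is the maximal depth of a node. The group of nonsimple butterfly permutations is the $n$-fold iterated wreath product $B_n=S_2\wr\cdots\wr S_2\subset S_{2^n}$, which has $2^{2^n-1}$ elements. Explicitly, $B_0$ is the trivial group $S_1$, and $B_{n+1}=\{\pi_1\oplus\pi_2,\ \pi_1\ominus\pi_2:\pi_1,\pi_2\in B_n\}$, where for $\pi_1,\pi_2\in S_M$ the permutation $\pi_1\oplus\pi_2\in S_{2M}$ has one-line notation $\pi_1(1)\cdots\pi_1(M)\,(\pi_2(1)+M)\cdots(\pi_2(M)+M)$ and $\pi_1\ominus\pi_2\in S_{2M}$ has one-line notation $(\pi_1(1)+M)\cdots(\pi_1(M)+M)\,\pi_2(1)\cdots\pi_2(M)$.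 *)

theory Defs
  imports "HOL-Library.Tree" "HOL-Combinatorics.Permutations"
    "HOL-Library.Landau_Symbols" "HOL-Probability.Probability_Mass_Function"
begin

fun bst_insert :: "'a::linorder \<Rightarrow> 'a tree \<Rightarrow> 'a tree" where
  "bst_insert x \<langle>\<rangle> = \<langle>\<langle>\<rangle>, x, \<langle>\<rangle>\<rangle>"
| "bst_insert x \<langle>l, a, r\<rangle> =
     (if x < a then \<langle>bst_insert x l, a, r\<rangle>
      else if a < x then \<langle>l, a, bst_insert x r\<rangle>
      else \<langle>l, a, r\<rangle>)"

definition bst_of_list :: "'a::linorder list \<Rightarrow> 'a tree" where
  "bst_of_list xs = fold bst_insert xs \<langle>\<rangle>"

fun node_depths :: "'a tree \<Rightarrow> nat set" where
  "node_depths \<langle>\<rangle> = {}"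
| "node_depths \<langle>l, a, r\<rangle> = insert 0 (Suc ` (node_depths l \<union> node_depths r))"

text \<open>The library function \<open>height\<close> counts nodes rather than edges on a longest path;
  the height used here is one less. It is only meaningful for nonempty trees.\<close>

definition max_depth :: "'a tree \<Rightarrow> nat" where
  "max_depth t = Max (node_depths t)"

lemma finite_node_depths: "finite (node_depths t)"
  by (induction t) auto

lemma height_eq_Suc_max_depth:
  assumes "t \<noteq> \<langle>\<rangle>"
  shows "height t = Suc (max_depth t)"
proof -
  have fin: "finite (node_depths t)" for t :: "'a tree"
    by (rule finite_node_depths)
  have ne: "node_depths t = {} \<longleftrightarrow> t = \<langle>\<rangle>" for t :: "'a tree"
    by (cases t) auto
  show ?thesis
    using assms
  proof (induction t)
    case (Node l a r)
    have img: "Max (Suc ` A) = Suc (Max A)" if "finite A" "A \<noteq> {}" for A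
      using mono_Max_commute[of Suc A] that by (simp add: mono_Suc)
    show ?case
      using Node fin ne[of l] ne[of r]
      by (cases "l = \<langle>\<rangle>"; cases "r = \<langle>\<rangle>")
        (auto simp: max_depth_def img Max_Un simp flip: image_Un)
  qed simp
qed

text \<open>An element of \<open>S\<^sub>k\<close> is a function permuting \<open>{1..k}\<close> and fixing all other numbers.\<close>

definition one_line :: "nat \<Rightarrow> (nat \<Rightarrow> nat) \<Rightarrow> nat list" where
  "one_line k p = map p [1..<k+1]"

definition perm_tree :: "nat \<Rightarrow> (nat \<Rightarrow> nat) \<Rightarrow> nat tree" where
  "perm_tree k p = bst_of_list (one_line k p)"

definition perm_oplus :: "nat \<Rightarrow> (nat \<Rightarrow> nat) \<Rightarrow> (nat \<Rightarrow> nat) \<Rightarrow> nat \<Rightarrow> nat" where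
  "perm_oplus M p q i =
     (if i \<in> {1..M} then p i
      else if i \<in> {M+1..2*M} then q (i - M) + M
      else i)"

definition perm_ominus :: "nat \<Rightarrow> (nat \<Rightarrow> nat) \<Rightarrow> (nat \<Rightarrow> nat) \<Rightarrow> nat \<Rightarrow> nat" where
  "perm_ominus M p q i =
     (if i \<in> {1..M} then p i + M
      else if i \<in> {M+1..2*M} then q (i - M)
      else i)"

fun butterfly_perms :: "nat \<Rightarrow> (nat \<Rightarrow> nat) set" where
  "butterfly_perms 0 = {id}"
| "butterfly_perms (Suc n) =
     {perm_oplus (2 ^ n) p q | p q. p \<in> butterfly_perms n \<and> q \<in> butterfly_perms n} \<union>
     {perm_ominus (2 ^ n) p q | p q. p \<in> butterfly_perms n \<and> q \<in> butterfly_perms n}"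

lemma one_line_perm_oplus:
  "one_line (2 * M) (perm_oplus M p q) = one_line M p @ map (\<lambda>x. x + M) (one_line M q)"
  by (rule nth_equalityI) (auto simp: one_line_def perm_oplus_def nth_append Suc_diff_le simp del: upt_Suc)

lemma one_line_perm_ominus:
  "one_line (2 * M) (perm_ominus M p q) = map (\<lambda>x. x + M) (one_line M p) @ one_line M q"
  by (rule nth_equalityI) (auto simp: one_line_def perm_ominus_def nth_append Suc_diff_le simp del: upt_Suc)

lemma permutes_if_inj:
  fixes f :: "nat \<Rightarrow> nat"
  assumes "\<And>i. i \<notin> A \<Longrightarrow> f i = i" "\<And>i. i \<in> A \<Longrightarrow> f i \<in> A" "inj_on f A" "finite A"
  shows "f permutes A"
proof (rule bij_imp_permutes)
  show "bij_betw f A A"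
    unfolding bij_betw_def using endo_inj_surj[of A f] assms by blast
qed (use assms in auto)

lemma perm_oplus_permutes:
  assumes "p permutes {1..M}" "q permutes {1..M}"
  shows "perm_oplus M p q permutes {1..2*M}"
proof (rule permutes_if_inj)
  have p: "p i \<in> {1..M}" if "i \<in> {1..M}" for i using assms(1) that permutes_in_image by metis
  have q: "q (i - M) \<in> {1..M}" if "i \<in> {M+1..2*M}" for i
  proof -
    have "i - M \<in> {1..M}" using that by auto
    then show ?thesis using assms(2) permutes_in_image by metis
  qed
  have ip: "inj p" and iq: "inj q" using assms permutes_inj by auto
  show "perm_oplus M p q i \<in> {1..2*M}" if "i \<in> {1..2*M}" for i
    using that p[of i] q[of i] by (auto simp: perm_oplus_def)
  show "inj_on (perm_oplus M p q) {1..2*M}"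
  proof (rule inj_onI)
    fix i j assume *: "i \<in> {1..2*M}" "j \<in> {1..2*M}" "perm_oplus M p q i = perm_oplus M p q j"
    show "i = j"
      using * p[of i] q[of i] p[of j] q[of j] injD[OF ip, of i j]
        injD[OF iq, of "i - M" "j - M"]
      by (auto simp: perm_oplus_def split: if_splits)
  qed
qed (auto simp: perm_oplus_def)

lemma perm_ominus_permutes:
  assumes "p permutes {1..M}" "q permutes {1..M}"
  shows "perm_ominus M p q permutes {1..2*M}"
proof (rule permutes_if_inj)
  have p: "p i \<in> {1..M}" if "i \<in> {1..M}" for i using assms(1) that permutes_in_image by metis
  have q: "q (i - M) \<in> {1..M}" if "i \<in> {M+1..2*M}" for i
  proof -
    have "i - M \<in> {1..M}" using that by auto
    then show ?thesis using assms(2) permutes_in_image by metis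
  qed
  have ip: "inj p" and iq: "inj q" using assms permutes_inj by auto
  show "perm_ominus M p q i \<in> {1..2*M}" if "i \<in> {1..2*M}" for i
    using that p[of i] q[of i] by (auto simp: perm_ominus_def)
  show "inj_on (perm_ominus M p q) {1..2*M}"
  proof (rule inj_onI)
    fix i j assume *: "i \<in> {1..2*M}" "j \<in> {1..2*M}" "perm_ominus M p q i = perm_ominus M p q j"
    show "i = j"
      using * p[of i] q[of i] p[of j] q[of j] injD[OF ip, of i j]
        injD[OF iq, of "i - M" "j - M"]
      by (auto simp: perm_ominus_def split: if_splits)
  qed
qed (auto simp: perm_ominus_def)

lemma butterfly_perms_permutes:
  "p \<in> butterfly_perms n \<Longrightarrow> p permutes {1..2 ^ n}"
proof (induction n arbitrary: p)
  case (Suc n)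
  then show ?case
    using perm_oplus_permutes[of _ "2 ^ n"] perm_ominus_permutes[of _ "2 ^ n"] by auto
qed (simp add: permutes_id)

lemma finite_butterfly_perms: "finite (butterfly_perms n)"
proof (rule finite_subset)
  show "butterfly_perms n \<subseteq> {p. p permutes {1..2 ^ n}}"
    using butterfly_perms_permutes by blast
qed (simp add: finite_permutations)

lemma butterfly_perms_nonempty: "butterfly_perms n \<noteq> {}"
  by (induction n) auto

lemma perm_oplus_inject:
  assumes "p permutes {1..M}" "q permutes {1..M}" "p' permutes {1..M}" "q' permutes {1..M}"
    and eq: "perm_oplus M p q = perm_oplus M p' q'"
  shows "p = p' \<and> q = q'"
proof (intro conjI ext)
  fix i
  show "p i = p' i"
    using fun_cong[OF eq, of i] assms(1,3)
    by (cases "i \<in> {1..M}") (auto simp: perm_oplus_def permutes_not_in)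
  show "q i = q' i"
    using fun_cong[OF eq, of "i + M"] assms(2,4)
    by (cases "i \<in> {1..M}") (auto simp: perm_oplus_def permutes_not_in)
qed

lemma perm_ominus_inject:
  assumes "p permutes {1..M}" "q permutes {1..M}" "p' permutes {1..M}" "q' permutes {1..M}"
    and eq: "perm_ominus M p q = perm_ominus M p' q'"
  shows "p = p' \<and> q = q'"
proof (intro conjI ext)
  fix i
  show "p i = p' i"
    using fun_cong[OF eq, of i] assms(1,3)
    by (cases "i \<in> {1..M}") (auto simp: perm_ominus_def permutes_not_in)
  show "q i = q' i"
    using fun_cong[OF eq, of "i + M"] assms(2,4)
    by (cases "i \<in> {1..M}") (auto simp: perm_ominus_def permutes_not_in)
qed

lemma perm_oplus_neq_ominus:
  assumes "p permutes {1..M}" "p' permutes {1..M}" "M \<ge> 1"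
  shows "perm_oplus M p q \<noteq> perm_ominus M p' q'"
proof
  assume "perm_oplus M p q = perm_ominus M p' q'"
  then have "p 1 = p' 1 + M"
    using assms(3) by (auto simp: perm_oplus_def perm_ominus_def dest: fun_cong[of _ _ 1])
  moreover have "p 1 \<in> {1..M}" "p' 1 \<in> {1..M}"
    using permutes_in_image[OF assms(1), of 1] permutes_in_image[OF assms(2), of 1] assms(3)
    by auto
  ultimately show False by auto
qed

lemma card_butterfly_perms: "card (butterfly_perms n) = 2 ^ (2 ^ n - 1)"
proof (induction n)
  case (Suc n)
  let ?B = "butterfly_perms n" and ?M = "2 ^ n :: nat"
  let ?P = "(\<lambda>(p, q). perm_oplus ?M p q) ` (?B \<times> ?B)"
  let ?Q = "(\<lambda>(p, q). perm_ominus ?M p q) ` (?B \<times> ?B)"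
  note perm = butterfly_perms_permutes[of _ n]
  have "butterfly_perms (Suc n) = ?P \<union> ?Q" by auto
  moreover have "?P \<inter> ?Q = {}"
    using perm_oplus_neq_ominus[of _ ?M] perm by fastforce
  moreover have "inj_on (\<lambda>(p, q). perm_oplus ?M p q) (?B \<times> ?B)"
    by (auto simp: inj_on_def dest: perm_oplus_inject[OF perm perm perm perm, rotated -1])
  moreover have "inj_on (\<lambda>(p, q). perm_ominus ?M p q) (?B \<times> ?B)"
    by (auto simp: inj_on_def dest: perm_ominus_inject[OF perm perm perm perm, rotated -1])
  ultimately have "card (butterfly_perms (Suc n)) = 2 * (card ?B * card ?B)"
    by (simp add: card_Un_disjoint card_image finite_butterfly_perms card_cartesian_product)
  also have "\<dots> = 2 ^ Suc ((?M - 1) + (?M - 1))"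
    by (simp only: Suc.IH power_add power_Suc)
  also have "Suc ((?M - 1) + (?M - 1)) = 2 ^ Suc n - 1"
    using one_le_power[of "2::nat" n] unfolding power_Suc by linarith
  finally show ?case .
qed simp

lemma butterfly_perms_comp:
  "p \<in> butterfly_perms n \<Longrightarrow> q \<in> butterfly_perms n \<Longrightarrow> p \<circ> q \<in> butterfly_perms n"
proof (induction n arbitrary: p q)
  case (Suc n)
  let ?B = "butterfly_perms n" and ?M = "2 ^ n :: nat"
  have comp:
    "perm_oplus ?M p q \<circ> perm_oplus ?M p' q' = perm_oplus ?M (p \<circ> p') (q \<circ> q')"
    "perm_ominus ?M p q \<circ> perm_oplus ?M p' q' = perm_ominus ?M (p \<circ> p') (q \<circ> q')"
    "perm_oplus ?M p q \<circ> perm_ominus ?M p' q' = perm_ominus ?M (q \<circ> p') (p \<circ> q')"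
    "perm_ominus ?M p q \<circ> perm_ominus ?M p' q' = perm_oplus ?M (q \<circ> p') (p \<circ> q')"
    if "p' \<in> ?B" "q' \<in> ?B" for p q p' q'
  proof -
    have p': "p' i \<in> {1..?M}" if "i \<in> {1..?M}" for i
      using butterfly_perms_permutes[OF \<open>p' \<in> ?B\<close>] that permutes_in_image by metis
    have q': "q' (i - ?M) \<in> {1..?M}" if "i \<in> {?M+1..2*?M}" for i
    proof -
      have "i - ?M \<in> {1..?M}" using that by auto
      then show ?thesis
        using butterfly_perms_permutes[OF \<open>q' \<in> ?B\<close>] permutes_in_image by metis
    qed
    have oplus: "perm_oplus ?M f g i = (if i \<in> {1..?M} then f i
        else if i \<in> {?M+1..2*?M} then g (i - ?M) + ?M else i)" for f g i
      by (simp add: perm_oplus_def)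
    have ominus: "perm_ominus ?M f g i = (if i \<in> {1..?M} then f i + ?M
        else if i \<in> {?M+1..2*?M} then g (i - ?M) else i)" for f g i
      by (simp add: perm_ominus_def)
    show "perm_oplus ?M p q \<circ> perm_oplus ?M p' q' = perm_oplus ?M (p \<circ> p') (q \<circ> q')"
      "perm_ominus ?M p q \<circ> perm_oplus ?M p' q' = perm_ominus ?M (p \<circ> p') (q \<circ> q')"
      "perm_oplus ?M p q \<circ> perm_ominus ?M p' q' = perm_ominus ?M (q \<circ> p') (p \<circ> q')"
      "perm_ominus ?M p q \<circ> perm_ominus ?M p' q' = perm_oplus ?M (q \<circ> p') (p \<circ> q')"
      using p' q' by (force simp: fun_eq_iff oplus ominus)+
  qed
  have oplus: "perm_oplus ?M f g \<in> butterfly_perms (Suc n)" if "f \<in> ?B" "g \<in> ?B" for f g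
    using that by auto
  have ominus: "perm_ominus ?M f g \<in> butterfly_perms (Suc n)" if "f \<in> ?B" "g \<in> ?B" for f g
    using that by auto
  from Suc.prems obtain f g f' g' where fg: "f \<in> ?B" "g \<in> ?B" "f' \<in> ?B" "g' \<in> ?B"
    and p: "p = perm_oplus ?M f g \<or> p = perm_ominus ?M f g"
    and q: "q = perm_oplus ?M f' g' \<or> q = perm_ominus ?M f' g'"
    by auto
  from p q show ?case
    by (elim disjE; simp only: comp fg Suc.IH oplus ominus)
qed simp

definition expected_butterfly_height :: "nat \<Rightarrow> real" where
  "expected_butterfly_height n =
     measure_pmf.expectation (pmf_of_set (butterfly_perms n))
       (\<lambda>p. real (max_depth (perm_tree (2 ^ n) p)))"

end

theory Submission imports Defs begin

text \<open>
  Let \<open>H\<close> be the height counted in nodes and let \<open>L\<close>, \<open>R\<close> be the numbers of nodes on the left and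
  right spine. The tree of \<open>\<pi>\<^sub>1 \<oplus> \<pi>\<^sub>2\<close> is the tree of \<open>\<pi>\<^sub>1\<close> with a copy of the tree of \<open>\<pi>\<^sub>2\<close> attached
  at the end of the right spine, so \<open>H = max H\<^sub>1 (R\<^sub>1 + H\<^sub>2)\<close>, \<open>R = R\<^sub>1 + R\<^sub>2\<close> and \<open>L = L\<^sub>1\<close>; the case
  of \<open>\<ominus>\<close> is the mirror image. Hence \<open>\<bbbE> L = \<bbbE> R = (3/2) ^ n\<close>, and \<open>H \<ge> R\<^sub>1 + H\<^sub>2\<close> sums to
  \<open>\<bbbE> H \<ge> 2 (3/2) ^ n - 1\<close>.

  For the upper bound, \<open>H\<^sup>2 \<le> H\<^sub>1\<^sup>2 + (R\<^sub>1 + H\<^sub>2)\<^sup>2\<close>, where \<open>R\<^sub>1\<close> and \<open>H\<^sub>2\<close> are independent and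
  \<open>\<bbbE> R\<^sup>2\<close> is of order \<open>(9/4) ^ n\<close>. As the coefficient of \<open>\<bbbE> H\<^sup>2\<close> in the resulting recursion is only
  \<open>2 < 9/4\<close>, it follows that \<open>\<bbbE> H\<^sup>2 \<le> 81 (9/4) ^ n\<close>. So \<open>\<bbbE> H \<le> 9 (3/2) ^ n\<close>, which is of smaller
  order than \<open>\<xi> ^ n\<close>: the true order of the expected height is \<open>N powr \<alpha>\<close>.
\<close>

section \<open>Grafting binary search trees\<close>

fun graft_right :: "'a tree \<Rightarrow> 'a tree \<Rightarrow> 'a tree" where
  "graft_right \<langle>\<rangle> s = s"
| "graft_right \<langle>l, a, r\<rangle> s = \<langle>l, a, graft_right r s\<rangle>"

fun graft_left :: "'a tree \<Rightarrow> 'a tree \<Rightarrow> 'a tree" where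
  "graft_left \<langle>\<rangle> s = s"
| "graft_left \<langle>l, a, r\<rangle> s = \<langle>graft_left l s, a, r\<rangle>"

fun right_spine :: "'a tree \<Rightarrow> nat" where
  "right_spine \<langle>\<rangle> = 0"
| "right_spine \<langle>l, a, r\<rangle> = Suc (right_spine r)"

fun left_spine :: "'a tree \<Rightarrow> nat" where
  "left_spine \<langle>\<rangle> = 0"
| "left_spine \<langle>l, a, r\<rangle> = Suc (left_spine l)"

lemma height_graft_right: "height (graft_right t s) = max (height t) (right_spine t + height s)"
  by (induction t) auto

lemma height_graft_left: "height (graft_left t s) = max (height t) (left_spine t + height s)"
  by (induction t) auto

lemma right_spine_graft_right: "right_spine (graft_right t s) = right_spine t + right_spine s"
  by (induction t) auto

lemma left_spine_graft_left: "left_spine (graft_left t s) = left_spine t + left_spine s"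
  by (induction t) auto

lemma left_spine_graft_right: "t \<noteq> \<langle>\<rangle> \<Longrightarrow> left_spine (graft_right t s) = left_spine t"
  by (cases t) auto

lemma right_spine_graft_left: "t \<noteq> \<langle>\<rangle> \<Longrightarrow> right_spine (graft_left t s) = right_spine t"
  by (cases t) auto

lemma right_spine_map_tree: "right_spine (map_tree f t) = right_spine t"
  by (induction t) auto

lemma left_spine_map_tree: "left_spine (map_tree f t) = left_spine t"
  by (induction t) auto

section \<open>Insertion of keys into grafted and relabelled trees\<close>

lemma set_tree_bst_insert: "set_tree (bst_insert x t) = insert x (set_tree t)"
  by (induction t) auto

lemma set_tree_fold_bst_insert: "set_tree (fold bst_insert xs t) = set xs \<union> set_tree t"
  by (induction xs arbitrary: t) (auto simp: set_tree_bst_insert)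

text \<open>A key above all keys of \<open>t\<close> turns right at every node of the right spine,
  so it reaches the grafted tree.\<close>

lemma bst_insert_graft_right:
  "\<forall>a\<in>set_tree t. a < x \<Longrightarrow> bst_insert x (graft_right t s) = graft_right t (bst_insert x s)"
  by (induction t) auto

lemma bst_insert_graft_left:
  "\<forall>a\<in>set_tree t. x < a \<Longrightarrow> bst_insert x (graft_left t s) = graft_left t (bst_insert x s)"
  by (induction t) auto

lemma fold_bst_insert_graft_right:
  "\<forall>a\<in>set_tree t. \<forall>x\<in>set xs. a < x \<Longrightarrow>
    fold bst_insert xs (graft_right t s) = graft_right t (fold bst_insert xs s)"
  by (induction xs arbitrary: s) (auto simp: bst_insert_graft_right)

lemma fold_bst_insert_graft_left:
  "\<forall>a\<in>set_tree t. \<forall>x\<in>set xs. x < a \<Longrightarrow>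
    fold bst_insert xs (graft_left t s) = graft_left t (fold bst_insert xs s)"
  by (induction xs arbitrary: s) (auto simp: bst_insert_graft_left)

lemma graft_right_Leaf: "graft_right t \<langle>\<rangle> = t"
  by (induction t) auto

lemma graft_left_Leaf: "graft_left t \<langle>\<rangle> = t"
  by (induction t) auto

lemma set_tree_bst_of_list: "set_tree (bst_of_list xs) = set xs"
  by (simp add: bst_of_list_def set_tree_fold_bst_insert)

lemma bst_of_list_append_right:
  assumes "\<And>x y. x \<in> set xs \<Longrightarrow> y \<in> set ys \<Longrightarrow> x < y"
  shows "bst_of_list (xs @ ys) = graft_right (bst_of_list xs) (bst_of_list ys)"
  using fold_bst_insert_graft_right[of "bst_of_list xs" ys "\<langle>\<rangle>"] assms
  by (simp add: set_tree_bst_of_list graft_right_Leaf) (simp add: bst_of_list_def)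

lemma bst_of_list_append_left:
  assumes "\<And>x y. x \<in> set xs \<Longrightarrow> y \<in> set ys \<Longrightarrow> y < x"
  shows "bst_of_list (xs @ ys) = graft_left (bst_of_list xs) (bst_of_list ys)"
  using fold_bst_insert_graft_left[of "bst_of_list xs" ys "\<langle>\<rangle>"] assms
  by (simp add: set_tree_bst_of_list graft_left_Leaf) (simp add: bst_of_list_def)

text \<open>Insertion only compares keys, and \<open>f\<close> preserves comparisons; applied to the
  shift by \<open>M\<close>.\<close>

lemma bst_insert_map_tree:
  "strict_mono f \<Longrightarrow> bst_insert (f x) (map_tree f t) = map_tree f (bst_insert x t)"
  by (induction t) (auto simp: strict_mono_less)

lemma bst_of_list_map:
  assumes "strict_mono f"
  shows "bst_of_list (map f xs) = map_tree f (bst_of_list xs)"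
proof -
  have "fold bst_insert (map f xs) (map_tree f t) = map_tree f (fold bst_insert xs t)" for t
    by (induction xs arbitrary: t) (simp_all add: bst_insert_map_tree[OF assms])
  from this[of "\<langle>\<rangle>"] show ?thesis by (simp add: bst_of_list_def)
qed

section \<open>Trees of butterfly permutations\<close>

lemma set_one_line:
  assumes "p permutes {1..k}"
  shows "set (one_line k p) = {1..k}"
proof -
  have "set (one_line k p) = p ` {1..k}"
    by (auto simp: one_line_def simp del: upt_Suc)
  then show ?thesis using permutes_image[OF assms] by simp
qed

lemma strict_mono_add_nat: "strict_mono (\<lambda>x. x + (M::nat))"
  by (simp add: strict_mono_def)

lemma perm_tree_oplus:
  assumes "p permutes {1..M}" "q permutes {1..M}"
  shows "perm_tree (2 * M) (perm_oplus M p q) =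
    graft_right (perm_tree M p) (map_tree (\<lambda>x. x + M) (perm_tree M q))"
  unfolding perm_tree_def one_line_perm_oplus
  by (subst bst_of_list_append_right)
    (auto simp: assms[THEN set_one_line] bst_of_list_map[OF strict_mono_add_nat])

lemma perm_tree_ominus:
  assumes "p permutes {1..M}" "q permutes {1..M}"
  shows "perm_tree (2 * M) (perm_ominus M p q) =
    graft_left (map_tree (\<lambda>x. x + M) (perm_tree M p)) (perm_tree M q)"
  unfolding perm_tree_def one_line_perm_ominus
  by (subst bst_of_list_append_left)
    (auto simp: assms[THEN set_one_line] bst_of_list_map[OF strict_mono_add_nat])

text \<open>Supplies the nonemptiness under which a graft leaves the opposite spine unchanged and
  \<open>height\<close> exceeds \<open>max_depth\<close> by one.\<close>

lemma perm_tree_not_Leaf: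
  assumes "p \<in> butterfly_perms n"
  shows "perm_tree (2 ^ n) p \<noteq> \<langle>\<rangle>"
proof -
  have "set_tree (perm_tree (2 ^ n) p) = {1..2 ^ n}"
    using set_one_line[OF butterfly_perms_permutes[OF assms]]
    by (simp add: perm_tree_def set_tree_bst_of_list)
  then show ?thesis by auto
qed

abbreviation butterfly_height :: "nat \<Rightarrow> (nat \<Rightarrow> nat) \<Rightarrow> real" where
  "butterfly_height n p \<equiv> real (height (perm_tree (2 ^ n) p))"

abbreviation butterfly_left :: "nat \<Rightarrow> (nat \<Rightarrow> nat) \<Rightarrow> real" where
  "butterfly_left n p \<equiv> real (left_spine (perm_tree (2 ^ n) p))"

abbreviation butterfly_right :: "nat \<Rightarrow> (nat \<Rightarrow> nat) \<Rightarrow> real" where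
  "butterfly_right n p \<equiv> real (right_spine (perm_tree (2 ^ n) p))"

lemma butterfly_oplus:
  assumes "p \<in> butterfly_perms n" "q \<in> butterfly_perms n"
  shows "butterfly_height (Suc n) (perm_oplus (2 ^ n) p q) =
      max (butterfly_height n p) (butterfly_right n p + butterfly_height n q)"
    and "butterfly_left (Suc n) (perm_oplus (2 ^ n) p q) = butterfly_left n p"
    and "butterfly_right (Suc n) (perm_oplus (2 ^ n) p q) = butterfly_right n p + butterfly_right n q"
  using perm_tree_not_Leaf[OF assms(1)] perm_tree_oplus[OF assms[THEN butterfly_perms_permutes]]
  by (simp_all add: height_graft_right left_spine_graft_right right_spine_graft_right
      right_spine_map_tree)

lemma butterfly_ominus:
  assumes "p \<in> butterfly_perms n" "q \<in> butterfly_perms n"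
  shows "butterfly_height (Suc n) (perm_ominus (2 ^ n) p q) =
      max (butterfly_height n p) (butterfly_left n p + butterfly_height n q)"
    and "butterfly_left (Suc n) (perm_ominus (2 ^ n) p q) = butterfly_left n p + butterfly_left n q"
    and "butterfly_right (Suc n) (perm_ominus (2 ^ n) p q) = butterfly_right n p"
  using perm_tree_not_Leaf[OF assms(1)] perm_tree_ominus[OF assms[THEN butterfly_perms_permutes]]
  by (simp_all add: height_graft_left left_spine_graft_left right_spine_graft_left
      left_spine_map_tree right_spine_map_tree)

lemma perm_tree_1: "perm_tree (Suc 0) id = \<langle>\<langle>\<rangle>, 1, \<langle>\<rangle>\<rangle>"
  by (simp add: perm_tree_def one_line_def bst_of_list_def)

section \<open>Averages over butterfly permutations\<close>

text \<open>With a plain finite average, independence of the two halves is expressed by nesting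
  means, and products factor by linearity.\<close>

definition butterfly_mean :: "nat \<Rightarrow> ((nat \<Rightarrow> nat) \<Rightarrow> real) \<Rightarrow> real" where
  "butterfly_mean n f = (\<Sum>p\<in>butterfly_perms n. f p) / real (card (butterfly_perms n))"

lemma expectation_eq_butterfly_mean:
  "measure_pmf.expectation (pmf_of_set (butterfly_perms n)) f = butterfly_mean n f"
  by (simp add: butterfly_mean_def integral_pmf_of_set finite_butterfly_perms
      butterfly_perms_nonempty)

lemma butterfly_mean_const: "butterfly_mean n (\<lambda>_. c) = c"
  using card_butterfly_perms[of n] by (simp add: butterfly_mean_def)

lemma butterfly_mean_add:
  "butterfly_mean n (\<lambda>p. f p + g p) = butterfly_mean n f + butterfly_mean n g"
  by (simp add: butterfly_mean_def sum.distrib add_divide_distrib)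

lemma butterfly_mean_mult_left: "butterfly_mean n (\<lambda>p. c * f p) = c * butterfly_mean n f"
  by (simp add: butterfly_mean_def flip: sum_distrib_left)

lemma butterfly_mean_mult_right: "butterfly_mean n (\<lambda>p. f p * c) = butterfly_mean n f * c"
  by (simp add: butterfly_mean_def flip: sum_distrib_right)

lemmas butterfly_mean_linear =
  butterfly_mean_const butterfly_mean_add butterfly_mean_mult_left butterfly_mean_mult_right

lemma butterfly_mean_mono:
  "(\<And>p. p \<in> butterfly_perms n \<Longrightarrow> f p \<le> g p) \<Longrightarrow> butterfly_mean n f \<le> butterfly_mean n g"
  by (simp add: butterfly_mean_def divide_right_mono sum_mono)

lemma butterfly_mean_cong:
  "(\<And>p. p \<in> butterfly_perms n \<Longrightarrow> f p = g p) \<Longrightarrow> butterfly_mean n f = butterfly_mean n g"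
  by (simp add: butterfly_mean_def)

lemma butterfly_mean_0: "butterfly_mean 0 f = f id"
  by (simp add: butterfly_mean_def)

text \<open>Both constructions are injective on pairs and their images are disjoint, so a uniform
  element arises from a fair choice between them applied to two independent uniform
  elements.\<close>

lemma butterfly_mean_Suc:
  "butterfly_mean (Suc n) f =
    (butterfly_mean n (\<lambda>p. butterfly_mean n (\<lambda>q. f (perm_oplus (2 ^ n) p q))) +
     butterfly_mean n (\<lambda>p. butterfly_mean n (\<lambda>q. f (perm_ominus (2 ^ n) p q)))) / 2"
proof -
  let ?B = "butterfly_perms n" and ?M = "2 ^ n :: nat"
  let ?P = "(\<lambda>(p, q). perm_oplus ?M p q) ` (?B \<times> ?B)"
  let ?Q = "(\<lambda>(p, q). perm_ominus ?M p q) ` (?B \<times> ?B)"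
  note perm = butterfly_perms_permutes[of _ n]
  have B: "butterfly_perms (Suc n) = ?P \<union> ?Q" by auto
  have disj: "?P \<inter> ?Q = {}"
    using perm_oplus_neq_ominus[of _ ?M] perm by fastforce
  have injP: "inj_on (\<lambda>(p, q). perm_oplus ?M p q) (?B \<times> ?B)"
    by (auto simp: inj_on_def dest: perm_oplus_inject[OF perm perm perm perm, rotated -1])
  have injQ: "inj_on (\<lambda>(p, q). perm_ominus ?M p q) (?B \<times> ?B)"
    by (auto simp: inj_on_def dest: perm_ominus_inject[OF perm perm perm perm, rotated -1])
  have fin: "finite ?P" "finite ?Q" by (simp_all add: finite_butterfly_perms)
  have sumP: "sum f ?P = (\<Sum>p\<in>?B. \<Sum>q\<in>?B. f (perm_oplus ?M p q))"
    unfolding sum.reindex[OF injP] by (simp add: sum.cartesian_product case_prod_unfold)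
  have sumQ: "sum f ?Q = (\<Sum>p\<in>?B. \<Sum>q\<in>?B. f (perm_ominus ?M p q))"
    unfolding sum.reindex[OF injQ] by (simp add: sum.cartesian_product case_prod_unfold)
  have card: "card (butterfly_perms (Suc n)) = 2 * (card ?B * card ?B)"
    unfolding B using card_Un_disjoint[OF fin disj] card_image[OF injP] card_image[OF injQ]
    by (simp add: card_cartesian_product)
  show ?thesis
    unfolding butterfly_mean_def card
    unfolding B sum.union_disjoint[OF fin disj] sumP sumQ
    by (simp add: mult_ac flip: sum_divide_distrib add_divide_distrib)
qed

lemma butterfly_mean_Suc_cong:
  assumes "\<And>p q. p \<in> butterfly_perms n \<Longrightarrow> q \<in> butterfly_perms n \<Longrightarrow> f (perm_oplus (2 ^ n) p q) = g p q"
    and "\<And>p q. p \<in> butterfly_perms n \<Longrightarrow> q \<in> butterfly_perms n \<Longrightarrow> f (perm_ominus (2 ^ n) p q) = h p q"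
  shows "butterfly_mean (Suc n) f =
    (butterfly_mean n (\<lambda>p. butterfly_mean n (g p)) + butterfly_mean n (\<lambda>p. butterfly_mean n (h p))) / 2"
  unfolding butterfly_mean_Suc
  by (intro arg_cong2[of _ _ _ _ "\<lambda>x y. (x + y) / 2"] butterfly_mean_cong assms)

section \<open>Moments of the spines and of the height\<close>

text \<open>One construction adds two left spines, the other keeps the first, so the mean grows by
  the factor \<open>(2 + 1) / 2\<close>.\<close>

lemma mean_butterfly_left: "butterfly_mean n (butterfly_left n) = (3/2) ^ n"
proof (induction n)
  case (Suc n)
  show ?case
    by (subst butterfly_mean_Suc_cong[OF butterfly_oplus(2) butterfly_ominus(2)])
      (simp_all add: butterfly_mean_linear Suc.IH)
qed (simp add: butterfly_mean_0 perm_tree_1)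

lemma mean_butterfly_right: "butterfly_mean n (butterfly_right n) = (3/2) ^ n"
proof (induction n)
  case (Suc n)
  show ?case
    by (subst butterfly_mean_Suc_cong[OF butterfly_oplus(3) butterfly_ominus(3)])
      (simp_all add: butterfly_mean_linear Suc.IH)
qed (simp add: butterfly_mean_0 perm_tree_1)

lemma three_halves_power_mult: "(3/2) ^ n * (3/2) ^ n = (9/4 :: real) ^ n"
  unfolding power_mult_distrib[symmetric] by simp

text \<open>By independence the cross term contributes \<open>(9/4) ^ n\<close>. The constant 4/3
  solves \<open>3/2 * C + 1 = 9/4 * C\<close>.\<close>

lemma mean_butterfly_left_sq: "butterfly_mean n (\<lambda>p. (butterfly_left n p)\<^sup>2) \<le> 4/3 * (9/4) ^ n"
proof (induction n)
  case (Suc n)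
  have "butterfly_mean (Suc n) (\<lambda>p. (butterfly_left (Suc n) p)\<^sup>2) =
      3/2 * butterfly_mean n (\<lambda>p. (butterfly_left n p)\<^sup>2) + (9/4) ^ n"
    by (subst butterfly_mean_Suc_cong[OF arg_cong[where f = "\<lambda>x. x\<^sup>2", OF butterfly_oplus(2)]
        arg_cong[where f = "\<lambda>x. x\<^sup>2", OF butterfly_ominus(2)]])
      (simp_all add: power2_sum butterfly_mean_linear mean_butterfly_left mult.assoc
        three_halves_power_mult)
  then show ?case using Suc.IH by simp
qed (simp add: butterfly_mean_0 perm_tree_1)

lemma mean_butterfly_right_sq: "butterfly_mean n (\<lambda>p. (butterfly_right n p)\<^sup>2) \<le> 4/3 * (9/4) ^ n"
proof (induction n)
  case (Suc n)
  have "butterfly_mean (Suc n) (\<lambda>p. (butterfly_right (Suc n) p)\<^sup>2) =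
      3/2 * butterfly_mean n (\<lambda>p. (butterfly_right n p)\<^sup>2) + (9/4) ^ n"
    by (subst butterfly_mean_Suc_cong[OF arg_cong[where f = "\<lambda>x. x\<^sup>2", OF butterfly_oplus(3)]
        arg_cong[where f = "\<lambda>x. x\<^sup>2", OF butterfly_ominus(3)]])
      (simp_all add: power2_sum butterfly_mean_linear mean_butterfly_right mult.assoc
        three_halves_power_mult)
  then show ?case using Suc.IH by simp
qed (simp add: butterfly_mean_0 perm_tree_1)

lemma mean_butterfly_height_ge: "butterfly_mean n (butterfly_height n) \<ge> 2 * (3/2) ^ n - 1"
proof (induction n)
  case (Suc n)
  let ?E = "butterfly_mean n"
  \<comment> \<open>Here \<open>s\<close> stands for either spine, which treats both constructions
    at once.\<close>
  have "?E (\<lambda>p. ?E (\<lambda>q. s p + butterfly_height n q))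
      \<le> ?E (\<lambda>p. ?E (\<lambda>q. max (butterfly_height n p) (s p + butterfly_height n q)))" for s
    by (intro butterfly_mean_mono) simp
  then have "?E s + ?E (butterfly_height n)
      \<le> ?E (\<lambda>p. ?E (\<lambda>q. max (butterfly_height n p) (s p + butterfly_height n q)))" for s
    by (simp add: butterfly_mean_linear)
  from this[of "butterfly_left n"] this[of "butterfly_right n"] show ?case
    using Suc.IH
    by (subst butterfly_mean_Suc_cong[OF butterfly_oplus(1) butterfly_ominus(1)])
      (simp_all add: mean_butterfly_left mean_butterfly_right)
qed (simp add: butterfly_mean_0 perm_tree_1)

text \<open>A form of Jensen's inequality: average
  \<open>2 * k * x \<le> x\<^sup>2 + k\<^sup>2\<close> and divide by \<open>2 * k\<close>.\<close>

lemma butterfly_mean_le_if_sq_le: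
  assumes "butterfly_mean n (\<lambda>p. (f p)\<^sup>2) \<le> k\<^sup>2" "k > 0"
  shows "butterfly_mean n f \<le> k"
proof -
  have "2 * k * f p \<le> (f p)\<^sup>2 + k\<^sup>2" for p
    using sum_squares_bound[of "f p" k] by (simp add: mult_ac)
  then have "butterfly_mean n (\<lambda>p. 2 * k * f p) \<le> butterfly_mean n (\<lambda>p. (f p)\<^sup>2 + k\<^sup>2)"
    by (intro butterfly_mean_mono)
  then have "2 * k * butterfly_mean n f \<le> 2 * k * k"
    using assms(1) by (simp add: butterfly_mean_linear power2_eq_square)
  then show ?thesis using assms(2) by simp
qed

lemma max_sq_le: "(max x y)\<^sup>2 \<le> x\<^sup>2 + (y::real)\<^sup>2"
  by (simp add: max_def)

lemma nine_three_halves_sq: "(9 * (3/2) ^ n)\<^sup>2 = 81 * (9/4 :: real) ^ n"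
  using three_halves_power_mult[of n] by (simp add: power2_eq_square)

text \<open>The constant 81 makes the induction close: \<open>2 * 81 + 4/3 + 2 * sqrt 81 \<le> 81 * 9/4\<close>.\<close>

lemma mean_butterfly_height_sq: "butterfly_mean n (\<lambda>p. (butterfly_height n p)\<^sup>2) \<le> 81 * (9/4) ^ n"
proof (induction n)
  case (Suc n)
  let ?E = "butterfly_mean n" and ?H = "butterfly_height n"
  \<comment> \<open>The induction hypothesis on the second moment also bounds the first moment,
    which enters through the cross term below.\<close>
  have H: "?E ?H \<le> 9 * (3/2) ^ n"
    by (rule butterfly_mean_le_if_sq_le[OF Suc.IH[folded nine_three_halves_sq]]) simp
  have bound: "?E (\<lambda>p. ?E (\<lambda>q. (max (?H p) (s p + ?H q))\<^sup>2)) \<le> 81 * (9/4) ^ Suc n"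
    if s: "?E s = (3/2) ^ n" "?E (\<lambda>p. (s p)\<^sup>2) \<le> 4/3 * (9/4) ^ n" for s
  proof -
    have "?E (\<lambda>p. ?E (\<lambda>q. (max (?H p) (s p + ?H q))\<^sup>2))
        \<le> ?E (\<lambda>p. ?E (\<lambda>q. (?H p)\<^sup>2 + (s p + ?H q)\<^sup>2))"
      by (intro butterfly_mean_mono max_sq_le)
    \<comment> \<open>The mean of \<open>s p * ?H q\<close> factors, since \<open>p\<close> and
      \<open>q\<close> are averaged separately.\<close>
    also have "\<dots> = 2 * ?E (\<lambda>p. (?H p)\<^sup>2) + ?E (\<lambda>p. (s p)\<^sup>2) + 2 * ((3/2) ^ n * ?E ?H)"
      by (simp add: power2_sum butterfly_mean_linear s(1) mult.assoc)
    also have "(3/2) ^ n * ?E ?H \<le> (3/2) ^ n * (9 * (3/2) ^ n)"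
      by (rule mult_left_mono[OF H]) simp
    also have "\<dots> = 9 * (9/4) ^ n"
      unfolding three_halves_power_mult[symmetric] by (simp only: mult_ac)
    finally show ?thesis using Suc.IH s(2) zero_le_power[of "9/4 :: real" n]
      unfolding power_Suc by linarith
  qed
  show ?case
    using bound[OF mean_butterfly_left mean_butterfly_left_sq]
      bound[OF mean_butterfly_right mean_butterfly_right_sq]
    by (subst butterfly_mean_Suc_cong[OF arg_cong[where f = "\<lambda>x. x\<^sup>2", OF butterfly_oplus(1)]
        arg_cong[where f = "\<lambda>x. x\<^sup>2", OF butterfly_ominus(1)]])
      simp_all
qed (simp add: butterfly_mean_0 perm_tree_1)

lemma mean_butterfly_height_le: "butterfly_mean n (butterfly_height n) \<le> 9 * (3/2) ^ n"
  by (rule butterfly_mean_le_if_sq_le[OF mean_butterfly_height_sq[folded nine_three_halves_sq]]) simp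

section \<open>From moment bounds to the asymptotic estimate\<close>

lemma expected_butterfly_height_eq:
  "expected_butterfly_height n = butterfly_mean n (butterfly_height n) - 1"
proof -
  have "butterfly_mean n (butterfly_height n) =
      butterfly_mean n (\<lambda>p. real (max_depth (perm_tree (2 ^ n) p)) + 1)"
    by (intro butterfly_mean_cong)
      (simp add: height_eq_Suc_max_depth[OF perm_tree_not_Leaf])
  then show ?thesis
    by (simp add: expected_butterfly_height_def expectation_eq_butterfly_mean
        butterfly_mean_linear)
qed

lemma two_power_powr_log:
  assumes "x > 0"
  shows "(2 ^ n) powr log 2 x = (x::real) ^ n"
proof -
  have "(2 ^ n) powr log 2 x = (2 powr real n) powr log 2 x"
    by (simp add: powr_realpow)
  also have "\<dots> = (2 powr log 2 x) powr real n"
    by (rule powr_powr_swap)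
  finally show ?thesis using assms by (simp add: powr_realpow)
qed

theorem theorem4:
  fixes \<alpha> \<beta> \<xi> c d :: real
  assumes "\<xi> = (1 + sqrt 2 + sqrt (2 * sqrt 2 - 1)) / 2"
    and "\<alpha> = log 2 (3 / 2)"
    and "\<beta> = log 2 \<xi>"
    and "c = 2"
    and "d = 2 / (sqrt 2 + sqrt (2 * sqrt 2 - 1) - 2)"
  shows "\<exists>\<epsilon> \<delta> :: nat \<Rightarrow> real. \<epsilon> \<in> o(\<lambda>_. 1) \<and> \<delta> \<in> o(\<lambda>_. 1) \<and>
    (\<forall>n\<ge>1. let N = (2::real) ^ n in
       c * N powr \<alpha> * (1 + \<epsilon> n) \<le> expected_butterfly_height n \<and>
       expected_butterfly_height n \<le> d * N powr \<beta> * (1 + \<delta> n))"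
proof -
  \<comment> \<open>These rough bounds suffice because \<open>5/4 + 6/5 > 2\<close>, which yields
    both \<xi> > 3/2 and a positive denominator of \<open>d\<close>.\<close>
  have "sqrt 2 \<ge> (5/4 :: real)" by (rule real_le_rsqrt) (simp add: power2_eq_square)
  moreover from this have "sqrt (2 * sqrt 2 - 1) \<ge> (6/5 :: real)"
    by (intro real_le_rsqrt) (simp add: power2_eq_square)
  ultimately have \<xi>: "\<xi> > 3/2" and d: "d > 0"
    by (simp_all add: assms(1,5))
  \<comment> \<open>\<epsilon> turns \<open>c * (3/2) ^ n\<close> into
    \<open>2 * (3/2) ^ n - 2\<close>, the node bound less one for counting edges. \<delta> makes
    \<open>d * \<xi> ^ n * \<delta> n\<close> equal to \<open>9 * (3/2) ^ n\<close>; it vanishes in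
    the limit because \<xi> > 3/2.\<close>
  define \<epsilon> \<delta> :: "nat \<Rightarrow> real" where
    "\<epsilon> n = - ((2/3) ^ n)" and "\<delta> n = 9 / d * (3 / (2 * \<xi>)) ^ n" for n
  have "\<epsilon> \<longlonglongrightarrow> - 0"
    unfolding \<epsilon>_def by (intro tendsto_minus LIMSEQ_power_zero) simp
  then have \<epsilon>: "\<epsilon> \<in> o(\<lambda>_. 1)" by (intro smalloI_tendsto) simp_all
  have "\<delta> \<longlonglongrightarrow> 9 / d * 0"
    unfolding \<delta>_def using \<xi> by (intro tendsto_mult tendsto_const LIMSEQ_power_zero) simp
  then have \<delta>: "\<delta> \<in> o(\<lambda>_. 1)" by (intro smalloI_tendsto) simp_all
  have lower: "c * (2 ^ n) powr \<alpha> * (1 + \<epsilon> n) \<le> expected_butterfly_height n" for n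
  proof -
    have "(3/2) ^ n * (2/3) ^ n = (1::real)"
      unfolding power_mult_distrib[symmetric] by simp
    moreover have "c * (2 ^ n) powr \<alpha> * (1 + \<epsilon> n) = 2 * (3/2) ^ n - 2 * ((3/2) ^ n * (2/3) ^ n)"
      unfolding assms(2,4) \<epsilon>_def two_power_powr_log[of "3/2" n, simplified]
      by (simp only: ring_distribs)
    ultimately show ?thesis
      using mean_butterfly_height_ge[of n] by (simp add: expected_butterfly_height_eq)
  qed
  have upper: "expected_butterfly_height n \<le> d * (2 ^ n) powr \<beta> * (1 + \<delta> n)" for n
  proof -
    have "\<xi> ^ n * (3 / (2 * \<xi>)) ^ n = (3/2) ^ n"
      unfolding power_mult_distrib[symmetric] using \<xi> by simp
    then have "d * \<xi> ^ n * \<delta> n = 9 * (3/2) ^ n"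
      using d by (simp add: \<delta>_def)
    then have "d * (2 ^ n) powr \<beta> * (1 + \<delta> n) = d * \<xi> ^ n + 9 * (3/2) ^ n"
      using \<xi> by (simp add: assms(3) two_power_powr_log distrib_left)
    moreover have "d * \<xi> ^ n \<ge> 0" using d \<xi> by simp
    ultimately show ?thesis
      using mean_butterfly_height_le[of n] by (simp add: expected_butterfly_height_eq)
  qed
  show ?thesis using \<epsilon> \<delta> lower upper by (auto simp: Let_def)
qed

end
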